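(* Consider the system $\dot x=f(x,t)$, $y=Cx$ with $C=[I_p\ \ 0_{p\times(n-p)}]$. Let $\lambda>0$. Suppose there exist matrix functions $M_{22}(t)=M_{22}(t)'\in\mathbb{R}^{(n-p)\times(n-p)}$ and $M_{21}(t)\in\mathbb{R}^{(n-p)\times p}$ and a constant $\alpha>0$ such that $M_{22}(t)>\alpha I$ for all $t$ and $$\dot M_{22}+M_{21}A_{12}+A_{12}'M_{21}'+M_{22}A_{22}+A_{22}'M_{22}\le-2\lambda M_{22}\qquad\text{for all }x,t.$$ Then the reduced-order observer $$\dot{\hat w}=\dot P\hat x+Pf(\hat x,t),\qquad \hat x=C^+y+\begin{bmatrix}0\\ \hat w\end{bmatrix},$$ where $$C^+=\begin{bmatrix}I_p\\ -M_{22}^{-1}M_{21}\end{bmatrix},\qquad P=\begin{bmatrix}M_{22}^{-1}M_{21}& I_{n-p}\end{bmatrix},$$ is globally exponentially stable with rate $\lambda$.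
   Context: The state is $x(t)\in\mathbb{R}^n$, the measured output is $y(t)\in\mathbb{R}^p$, $t\in[0,\infty)$, and $f:\mathbb{R}^n\times[0,\infty)\to\mathbb{R}^n$ is smooth; $M_{21},M_{22}$ are smooth functions of $t$. A prime denotes transpose; matrix inequalities are in the sense of symmetric matrices. $A(x,t)=\frac{\partial f}{\partial x}(x,t)$ is partitioned conformally with $x=(x_1,x_2)$, $x_1\in\mathbb{R}^p$, $x_2\in\mathbb{R}^{n-p}$, as $A=\begin{bmatrix}A_{11}&A_{12}\\ A_{21}&A_{22}\end{bmatrix}$, so $A_{12}(x,t)\in\mathbb{R}^{p\times(n-p)}$ and $A_{22}(x,t)\in\mathbb{R}^{(n-p)\times(n-p)}$. $\dot P$ is the time derivative of $P(t)$. The observer state is $\hat w(t)\in\mathbb{R}^{n-p}$ and $\hat x(t)\in\mathbb{R}^n$ is the state estimate. The observer is globally exponentially stable with rate $\lambda$ if there is a constant $K$ such that for every system solution $x$ on $[0,\infty)$ (with $y=Cx$) and every observer initial condition $\hat w(0)$, the estimate exists for all $t\ge0$ and $|\hat x(t)-x(t)|\le Ke^{-\lambda t}|\hat x(0)-x(0)|$. *)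

theory Defs
  imports "HOL-Analysis.Analysis"
begin

text \<open>Smoothness on a set that may have a boundary, such as a half-space or a half-line:
  all iterated directional derivatives relative to the set exist and are continuous on it.
  It is only used for convex sets with nonempty interior, on which derivatives relative to
  the set are unique.\<close>

primrec Ck_on :: "nat \<Rightarrow> ('a::real_normed_vector \<Rightarrow> 'b::real_normed_vector) \<Rightarrow> 'a set \<Rightarrow> bool" where
  "Ck_on 0 f S \<longleftrightarrow> continuous_on S f"
| "Ck_on (Suc k) f S \<longleftrightarrow> f differentiable_on S \<and>
     (\<forall>v. Ck_on k (\<lambda>x. frechet_derivative f (at x within S) v) S)"

definition smooth_on :: "('a::real_normed_vector \<Rightarrow> 'b::real_normed_vector) \<Rightarrow> 'a set \<Rightarrow> bool" where
  "smooth_on f S \<longleftrightarrow> (\<forall>k. Ck_on k f S)"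

text \<open>Block vectors and matrices. The index type \<open>'p + 'q\<close> plays the role of
  \<open>{1, \<dots>, n}\<close>, split into the first \<open>p\<close> and the last \<open>n - p\<close> indices. A matrix is a vector of
  rows, so \<open>vstack\<close> stacks column vectors as well as matrices.\<close>

definition vstack :: "'a^'p::finite \<Rightarrow> 'a^'q::finite \<Rightarrow> 'a^('p + 'q)" where
  "vstack a b = (\<chi> k. case k of Inl i \<Rightarrow> a $ i | Inr j \<Rightarrow> b $ j)"

definition hstack :: "'a^'p::finite^'m::finite \<Rightarrow> 'a^'q::finite^'m \<Rightarrow> 'a^('p + 'q)^'m" where
  "hstack A B = (\<chi> i. vstack (A $ i) (B $ i))"

definition block12 :: "'a^('p::finite + 'q::finite)^('p + 'q) \<Rightarrow> 'a^'q^'p" where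
  "block12 A = (\<chi> i j. A $ Inl i $ Inr j)"

definition block22 :: "'a^('p::finite + 'q::finite)^('p + 'q) \<Rightarrow> 'a^'q^'q" where
  "block22 A = (\<chi> i j. A $ Inr i $ Inr j)"

definition pos_semidef :: "real^'n::finite^'n \<Rightarrow> bool" where
  "pos_semidef A \<longleftrightarrow> transpose A = A \<and> (\<forall>v. 0 \<le> v \<bullet> (A *v v))"

definition pos_def :: "real^'n::finite^'n \<Rightarrow> bool" where
  "pos_def A \<longleftrightarrow> transpose A = A \<and> (\<forall>v. v \<noteq> 0 \<longrightarrow> 0 < v \<bullet> (A *v v))"

definition loewner_le :: "real^'n::finite^'n \<Rightarrow> real^'n^'n \<Rightarrow> bool"  (infix "\<preceq>\<^sub>L" 50) where
  "A \<preceq>\<^sub>L B \<longleftrightarrow> pos_semidef (B - A)"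

definition loewner_less :: "real^'n::finite^'n \<Rightarrow> real^'n^'n \<Rightarrow> bool"  (infix "\<prec>\<^sub>L" 50) where
  "A \<prec>\<^sub>L B \<longleftrightarrow> pos_def (B - A)"

text \<open>Time derivative on \<open>[0, \<infinity>)\<close>, one-sided at \<open>0\<close>.\<close>

definition time_deriv :: "(real \<Rightarrow> 'a::real_normed_vector) \<Rightarrow> real \<Rightarrow> 'a" where
  "time_deriv M t = vector_derivative M (at t within {0..})"

definition ode_solution :: "('a::real_normed_vector \<Rightarrow> real \<Rightarrow> 'a) \<Rightarrow> (real \<Rightarrow> 'a) \<Rightarrow> bool" where
  "ode_solution F x \<longleftrightarrow>
     (\<forall>t\<ge>0. (x has_vector_derivative F (x t) t) (at t within {0..}))"

text \<open>An observer for \<open>x' = f(x,t)\<close>, \<open>y = C x\<close> has a state \<open>w\<close> with dynamics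
  \<open>w' = G(w,y,t)\<close> and produces the estimate \<open>H(w,y,t)\<close> of \<open>x\<close>. The constant \<open>K\<close> is uniform
  in the system solution and in the initial observer state.\<close>

definition glob_exp_stable_observer ::
  "(real^'n::finite \<Rightarrow> real \<Rightarrow> real^'n) \<Rightarrow> real^'n^'p::finite \<Rightarrow>
   (real^'q::finite \<Rightarrow> real^'p \<Rightarrow> real \<Rightarrow> real^'q) \<Rightarrow>
   (real^'q \<Rightarrow> real^'p \<Rightarrow> real \<Rightarrow> real^'n) \<Rightarrow> real \<Rightarrow> bool" where
  "glob_exp_stable_observer f C G H rate \<longleftrightarrow>
    (\<exists>K. \<forall>x. ode_solution f x \<longrightarrow>
      (\<forall>w0.
        (\<exists>w. w 0 = w0 \<and> ode_solution (\<lambda>v t. G v (C *v x t) t) w) \<and>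
        (\<forall>w. w 0 = w0 \<and> ode_solution (\<lambda>v t. G v (C *v x t) t) w \<longrightarrow>
          (\<forall>t\<ge>0. norm (H (w t) (C *v x t) t - x t)
             \<le> K * exp (- rate * t) * norm (H (w 0) (C *v x 0) 0 - x 0)))))"

definition output_matrix :: "real^('p::finite + 'q::finite)^'p" where
  "output_matrix = hstack (mat 1) 0"

definition C_plus :: "(real \<Rightarrow> real^'p::finite^'q::finite) \<Rightarrow> (real \<Rightarrow> real^'q^'q) \<Rightarrow>
    real \<Rightarrow> real^'p^('p + 'q)" where
  "C_plus M21 M22 t = vstack (mat 1) (- (matrix_inv (M22 t) ** M21 t))"

definition P_mat :: "(real \<Rightarrow> real^'p::finite^'q::finite) \<Rightarrow> (real \<Rightarrow> real^'q^'q) \<Rightarrow>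
    real \<Rightarrow> real^('p + 'q)^'q" where
  "P_mat M21 M22 t = hstack (matrix_inv (M22 t) ** M21 t) (mat 1)"

definition observer_estimate :: "(real \<Rightarrow> real^'p::finite^'q::finite) \<Rightarrow> (real \<Rightarrow> real^'q^'q) \<Rightarrow>
    real^'q \<Rightarrow> real^'p \<Rightarrow> real \<Rightarrow> real^('p + 'q)" where
  "observer_estimate M21 M22 w y t = C_plus M21 M22 t *v y + vstack 0 w"

definition observer_field :: "(real^('p::finite + 'q::finite) \<Rightarrow> real \<Rightarrow> real^('p + 'q)) \<Rightarrow>
    (real \<Rightarrow> real^'p^'q) \<Rightarrow> (real \<Rightarrow> real^'q^'q) \<Rightarrow>
    real^'q \<Rightarrow> real^'p \<Rightarrow> real \<Rightarrow> real^'q" where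
  "observer_field f M21 M22 w y t =
    (let xh = observer_estimate M21 M22 w y t
     in time_deriv (P_mat M21 M22) t *v xh + P_mat M21 M22 t *v f xh t)"

end

theory Submission
  imports Defs
begin

text \<open>With \<open>P = [M\<^sub>2\<^sub>2\<^sup>-\<^sup>1 M\<^sub>2\<^sub>1, I]\<close> the estimate satisfies \<open>xh - x = (0, e)\<close>, where \<open>e = w - P x\<close>. The last block
  column of \<open>P\<close> is constant, so the term with the derivative of \<open>P\<close> vanishes on \<open>(0, e)\<close> and
  \<open>e' = P (f (x + (0, e), t) - f (x, t))\<close>. For \<open>V = e \<bullet> M\<^sub>2\<^sub>2 e\<close>, the mean value theorem applied
  to \<open>s \<mapsto> e \<bullet> [M\<^sub>2\<^sub>1, M\<^sub>2\<^sub>2] f (x + s (0, e), t)\<close> and the matrix inequality at the intermediate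
  point give \<open>V' \<le> - 2 rate V\<close>, hence \<open>|e t| \<le> K exp (- rate t) |e 0|\<close> with
  \<open>K\<^sup>2 = |M\<^sub>2\<^sub>2 0| / \<alpha>\<close>.

  The observer has a solution for all time because the error equation, with \<open>e\<close> projected to a
  ball of radius larger than \<open>K |e 0|\<close> and \<open>|e 0|\<close>, is globally Lipschitz in \<open>e\<close>, uniformly on
  compact time intervals. Its solution obeys the same decay estimate up to the first time at which
  it reaches the sphere, so it never reaches it and solves the original equation.\<close>

subsection \<open>Global solutions of Lipschitz differential equations\<close>

lemma at_within_Icc_Ici:
  fixes t :: real
  assumes "a \<le> t" "t < T"
  shows "at t within {a..T} = at t within {a..}"
  by (rule at_within_nhd[where S = "{..<T}"]) (use assms in auto)

lemma has_vector_derivative_integral_Ici: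
  fixes g :: "real \<Rightarrow> 'a::banach"
  assumes "continuous_on {a..} g" "a \<le> t"
  shows "((\<lambda>u. integral {a..u} g) has_vector_derivative g t) (at t within {a..})"
proof -
  have "continuous_on {a..t + 1} g"
    using assms by (auto intro: continuous_on_subset)
  from integral_has_vector_derivative[OF this, of t] show ?thesis
    using assms at_within_Icc_Ici[of a t "t + 1"] by simp
qed

text \<open>The recursion between successive Picard error bounds: integrating \<open>c\<close> times
  the \<open>k\<close>-th term of the exponential series of \<open>c * s\<close> produces the next
  term.\<close>

lemma integral_power_div_fact:
  fixes c :: real
  assumes "0 \<le> t"
  shows "((\<lambda>s. c ^ Suc k * s ^ k / fact k) has_integral (c * t) ^ Suc k / fact (Suc k)) {0..t}"
proof -
  have "((\<lambda>s. c ^ Suc k * s ^ k / fact k) has_integral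
      (c * t) ^ Suc k / fact (Suc k) - (c * 0) ^ Suc k / fact (Suc k)) {0..t}"
  proof (rule fundamental_theorem_of_calculus[OF assms])
    fix s
    have *: "((\<lambda>s. (c * s) ^ Suc k / fact (Suc k)) has_real_derivative
        (real (Suc k) * (c * s) ^ k * c) / fact (Suc k)) (at s within {0..t})"
      by (auto intro!: derivative_eq_intros simp del: power_Suc)
    have "real (Suc k) * (c * s) ^ k * c / fact (Suc k) = c ^ Suc k * s ^ k / fact k"
      by (simp add: power_mult_distrib ac_simps del: of_nat_Suc)
    with * show "((\<lambda>s. (c * s) ^ Suc k / fact (Suc k)) has_vector_derivative
        c ^ Suc k * s ^ k / fact k) (at s within {0..t})"
      by (simp only: has_real_derivative_iff_has_vector_derivative)
  qed
  then show ?thesis by simp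
qed

text \<open>Picard iteration. The factorial in the bound on successive iterates gives uniform
  convergence on \<open>{0..T}\<close> for every \<open>T\<close>, so no short intervals have to be
  glued together and the Lipschitz constant may grow with \<open>T\<close>.\<close>

lemma ode_solution_exists:
  fixes F :: "'a::banach \<Rightarrow> real \<Rightarrow> 'a"
  assumes cont: "continuous_on (UNIV \<times> {0..}) (\<lambda>(v, t). F v t)"
    and lip: "\<And>T. \<exists>L. \<forall>t\<in>{0..T}. \<forall>u v. norm (F u t - F v t) \<le> L * norm (u - v)"
  shows "\<exists>w. w 0 = w0 \<and> ode_solution F w"
proof -
  define E where "E = rec_nat (\<lambda>_. w0) (\<lambda>_ e t. w0 + integral {0..t} (\<lambda>s. F (e s) s))"
  have E0: "E 0 = (\<lambda>_. w0)" and
    ES: "E (Suc k) = (\<lambda>t. w0 + integral {0..t} (\<lambda>s. F (E k s) s))" for k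
    by (simp_all add: E_def)
  have contF: "continuous_on {0..} (\<lambda>s. F (e s) s)" if "continuous_on {0..} e" for e
    using continuous_on_compose2[OF cont continuous_on_Pair[OF that continuous_on_id]] by auto
  have contE: "continuous_on {0..} (E k)" for k
  proof (induction k)
    case (Suc k)
    have "continuous_on {0..} (\<lambda>t. integral {0..t} (\<lambda>s. F (E k s) s))"
      unfolding continuous_on_eq_continuous_within
      by (auto intro!: has_vector_derivative_continuous
            has_vector_derivative_integral_Ici contF[OF Suc])
    then show ?case by (auto simp: ES intro!: continuous_intros)
  qed (simp add: E0)
  have unif: "uniformly_convergent_on {0..T} E" if T: "0 \<le> T" for T
  proof -
    obtain L0 where L0: "\<And>t u v. t \<in> {0..T} \<Longrightarrow> norm (F u t - F v t) \<le> L0 * norm (u - v)"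
      using lip[of T] by blast
    \<comment> \<open>Nothing fixes the sign of \<open>L0\<close>; a nonnegative constant is
      required to multiply inequalities by it and to compare powers of \<open>L * t\<close> and
      \<open>L * T\<close>.\<close>
    define L where "L = max L0 0"
    have L: "norm (F u t - F v t) \<le> L * norm (u - v)" if "t \<in> {0..T}" for t u v
      using L0[OF that, of u v] mult_right_mono[of L0 L "norm (u - v)"]
      unfolding L_def by simp
    have "compact ((\<lambda>t. E 1 t - E 0 t) ` {0..T})"
      by (intro compact_continuous_image continuous_intros continuous_on_subset[OF contE]) auto
    then obtain M where M: "\<And>t. t \<in> {0..T} \<Longrightarrow> norm (E 1 t - E 0 t) \<le> M"
      by (fastforce dest!: compact_imp_bounded simp: bounded_iff)
    have M0: "M \<ge> 0" using order_trans[OF norm_ge_zero M[of 0]] T by simp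
    have step: "norm (E (Suc k) t - E k t) \<le> M * ((L * t) ^ k / fact k)" if "t \<in> {0..T}" for k t
      using that
    proof (induction k arbitrary: t)
      case 0
      then show ?case using M by simp
    next
      case (Suc k)
      have sub: "{0..t} \<subseteq> {0..}" by auto
      have int: "(\<lambda>s. F (E k s) s) integrable_on {0..t}" for k
        by (rule integrable_continuous_real) (rule continuous_on_subset[OF contF[OF contE] sub])
      have "E (Suc (Suc k)) t - E (Suc k) t =
          integral {0..t} (\<lambda>s. F (E (Suc k) s) s) - integral {0..t} (\<lambda>s. F (E k s) s)"
        using fun_cong[OF ES[of "Suc k"], of t] fun_cong[OF ES[of k], of t] by simp
      then have "norm (E (Suc (Suc k)) t - E (Suc k) t) =
          norm (integral {0..t} (\<lambda>s. F (E (Suc k) s) s - F (E k s) s))"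
        by (simp only: integral_diff[OF int int])
      also have "\<dots> \<le> integral {0..t} (\<lambda>s. M * (L ^ Suc k * s ^ k / fact k))"
      proof (rule integral_norm_bound_integral)
        show "(\<lambda>s. F (E (Suc k) s) s - F (E k s) s) integrable_on {0..t}"
          by (intro integrable_diff int)
        show "(\<lambda>s. M * (L ^ Suc k * s ^ k / fact k)) integrable_on {0..t}"
          by (intro integrable_continuous_real continuous_intros) auto
        fix s assume "s \<in> {0..t}"
        then have s: "s \<in> {0..T}" using Suc.prems by auto
        have "norm (F (E (Suc k) s) s - F (E k s) s) \<le> L * norm (E (Suc k) s - E k s)"
          by (rule L[OF s])
        also have "\<dots> \<le> L * (M * ((L * s) ^ k / fact k))"
          by (intro mult_left_mono Suc.IH s) (simp add: L_def)
        finally show "norm (F (E (Suc k) s) s - F (E k s) s) \<le> M * (L ^ Suc k * s ^ k / fact k)"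
          by (simp add: power_mult_distrib ac_simps)
      qed
      also have "\<dots> = M * ((L * t) ^ Suc k / fact (Suc k))"
        using integral_power_div_fact[of t L k] Suc.prems
        by (intro integral_unique has_integral_mult_right) auto
      finally show ?case .
    qed
    \<comment> \<open>Replacing \<open>t\<close> by \<open>T\<close> makes the bound uniform in
      \<open>t\<close>, as the Weierstrass M-test requires; the majorant is \<open>M\<close> times
      the exponential series of \<open>L * T\<close>.\<close>
    have step': "norm (E (Suc k) t - E k t) \<le> M * ((L * T) ^ k / fact k)" if "t \<in> {0..T}" for k t
    proof (rule order_trans[OF step[OF that]])
      show "M * ((L * t) ^ k / fact k) \<le> M * ((L * T) ^ k / fact k)"
        using that by (intro mult_left_mono divide_right_mono power_mono M0) (auto simp: L_def)
    qed
    have "summable (\<lambda>k. M * ((L * T) ^ k / fact k))"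
      using summable_exp[of "L * T"] by (intro summable_mult) (simp add: field_simps)
    from Weierstrass_m_test[OF step' this]
    have "uniform_limit {0..T} (\<lambda>n t. \<Sum>k<n. E (Suc k) t - E k t)
        (\<lambda>t. \<Sum>k. E (Suc k) t - E k t) sequentially" .
    moreover have "(\<Sum>k<n. E (Suc k) t - E k t) = E n t - w0" for n t
      by (subst sum_lessThan_telescope) (simp add: E0)
    ultimately have "uniform_limit {0..T} (\<lambda>n t. E n t - w0)
        (\<lambda>t. \<Sum>k. E (Suc k) t - E k t) sequentially" by simp
    then have "uniform_limit {0..T} (\<lambda>n t. E n t - w0 + w0)
        (\<lambda>t. (\<Sum>k. E (Suc k) t - E k t) + w0) sequentially"
      by (intro uniform_limit_intros)
    then show ?thesis by (auto simp: uniformly_convergent_on_def)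
  qed
  \<comment> \<open>The pointwise limit does not mention \<open>T\<close>, so the uniform limits on
    all intervals \<open>{0..T}\<close> are restrictions of one function.\<close>
  define w where "w t = lim (\<lambda>n. E n t)" for t
  have unif_w: "uniform_limit {0..T} E w sequentially" if T: "0 \<le> T" for T
    using unif[OF T] unfolding w_def uniformly_convergent_uniform_limit_iff .
  have cont_w_T: "continuous_on {0..T} w" if "0 \<le> T" for T
    by (rule uniform_limit_theorem[OF _ unif_w[OF that]])
       (auto intro!: always_eventually continuous_on_subset[OF contE])
  have cont_w: "continuous_on {0..} w"
    unfolding continuous_on_eq_continuous_within
  proof
    fix t :: real assume t: "t \<in> {0..}"
    then have "continuous (at t within {0..t + 1}) w"
      using cont_w_T[of "t + 1"] by (auto simp: continuous_on_eq_continuous_within)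
    then show "continuous (at t within {0..}) w"
      using at_within_Icc_Ici[of 0 t "t + 1"] t by simp
  qed
  have w_eq: "w t = w0 + integral {0..t} (\<lambda>s. F (w s) s)" if t: "0 \<le> t" for t
  proof -
    obtain L where L: "\<And>s u v. s \<in> {0..t} \<Longrightarrow> norm (F u s - F v s) \<le> L * norm (u - v)"
      using lip[of t] by blast
    \<comment> \<open>The Lipschitz bound carries uniform convergence over from the iterates to the
      integrands, which permits the limit under the integral. The summand 1 in
      \<open>\<bar>L\<bar> + 1\<close> keeps the denominator of \<open>\<delta>\<close>
      positive.\<close>
    have "uniform_limit {0..t} (\<lambda>n s. F (E n s) s) (\<lambda>s. F (w s) s) sequentially"
    proof (rule uniform_limitI)
      fix \<epsilon> :: real assume \<epsilon>: "\<epsilon> > 0"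
      define \<delta> where "\<delta> = \<epsilon> / (\<bar>L\<bar> + 1)"
      have \<delta>: "\<delta> > 0" using \<epsilon> by (auto simp: \<delta>_def intro!: divide_pos_pos)
      have "\<forall>\<^sub>F n in sequentially. \<forall>s\<in>{0..t}. dist (E n s) (w s) < \<delta>"
        using uniform_limitD[OF unif_w[OF t] \<delta>] .
      then show "\<forall>\<^sub>F n in sequentially. \<forall>s\<in>{0..t}. dist (F (E n s) s) (F (w s) s) < \<epsilon>"
      proof (eventually_elim, intro ballI)
        fix n s assume *: "\<forall>s\<in>{0..t}. dist (E n s) (w s) < \<delta>" and s: "s \<in> {0..t}"
        have "dist (F (E n s) s) (F (w s) s) \<le> L * norm (E n s - w s)"
          using L[OF s] by (simp add: dist_norm)
        also have "\<dots> \<le> (\<bar>L\<bar> + 1) * norm (E n s - w s)"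
          by (intro mult_right_mono) auto
        also have "\<dots> < (\<bar>L\<bar> + 1) * \<delta>"
          using * s by (intro mult_strict_left_mono) (auto simp: dist_norm)
        finally show "dist (F (E n s) s) (F (w s) s) < \<epsilon>" by (simp add: \<delta>_def)
      qed
    qed
    then obtain I J where I: "\<And>n. ((\<lambda>s. F (E n s) s) has_integral I n) {0..t}"
      and J: "((\<lambda>s. F (w s) s) has_integral J) {0..t}" and IJ: "I \<longlonglongrightarrow> J"
      by (rule uniform_limit_integral)
         (auto intro!: continuous_on_subset[OF contF[OF contE]])
    have "(\<lambda>n. E (Suc n) t) \<longlonglongrightarrow> w0 + J"
      using IJ integral_unique[OF I] by (auto simp: ES intro!: tendsto_intros)
    moreover have "(\<lambda>n. E (Suc n) t) \<longlonglongrightarrow> w t"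
      using tendsto_uniform_limitI[OF unif_w[OF t], of t] t by (intro LIMSEQ_Suc) auto
    ultimately show ?thesis
      using J by (metis LIMSEQ_unique integral_unique)
  qed
  have "ode_solution F w"
    unfolding ode_solution_def
  proof (intro allI impI)
    fix t :: real assume t: "t \<ge> 0"
    have "((\<lambda>u. w0 + integral {0..u} (\<lambda>s. F (w s) s)) has_vector_derivative 0 + F (w t) t)
        (at t within {0..})"
      by (intro has_vector_derivative_add has_vector_derivative_const
            has_vector_derivative_integral_Ici contF cont_w t)
    then show "(w has_vector_derivative F (w t) t) (at t within {0..})"
      using has_vector_derivative_transform[of t "{0..}" w, OF _ w_eq] t by simp
  qed
  moreover have "w 0 = w0" using w_eq[of 0] by simp
  ultimately show ?thesis by blast
qed

subsection \<open>Block matrices and matrix inverses\<close>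

text \<open>Continuity and the product rule for matrix-valued functions of time are obtained from
  the theory of bounded bilinear maps.\<close>

lemma bounded_bilinear_matrix_vector_mult:
  "bounded_bilinear ((*v) :: real^'n::finite^'m::finite \<Rightarrow> _)"
  unfolding bilinear_conv_bounded_bilinear[symmetric] bilinear_def
  by (auto intro!: linearI simp: matrix_vector_mult_add_rdistrib matrix_vector_right_distrib
        matrix_vector_mult_scaleR scaleR_matrix_vector_assoc)

lemma bounded_bilinear_matrix_matrix_mult:
  "bounded_bilinear ((**) :: real^'n::finite^'m::finite \<Rightarrow> real^'k::finite^'n \<Rightarrow> _)"
  unfolding bilinear_conv_bounded_bilinear[symmetric] bilinear_def
  by (auto intro!: linearI simp: vec_eq_iff matrix_matrix_mult_def sum.distrib
        sum_distrib_left algebra_simps)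

lemma sum_UNIV_Plus:
  fixes g :: "'p::finite + 'q::finite \<Rightarrow> 'a::comm_monoid_add"
  shows "sum g UNIV = (\<Sum>i\<in>UNIV. g (Inl i)) + (\<Sum>j\<in>UNIV. g (Inr j))"
  by (subst UNIV_Plus_UNIV[symmetric], subst sum.Plus) auto

lemma vstack_nth [simp]: "vstack a b $ Inl i = a $ i" "vstack a b $ Inr j = b $ j"
  by (simp_all add: vstack_def)

lemma vec_eq_Plus_iff:
  "x = y \<longleftrightarrow> (\<forall>i. x $ Inl i = y $ Inl i) \<and> (\<forall>j. x $ Inr j = y $ Inr j)"
  unfolding vec_eq_iff by (rule split_sum_all)

lemma vstack_split: "vstack (\<chi> i. x $ Inl i) (\<chi> j. x $ Inr j) = x"
  by (simp add: vec_eq_Plus_iff)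

lemma hstack_mult_vstack:
  fixes A :: "real^'p::finite^'m::finite"
  shows "hstack A B *v vstack a b = A *v a + B *v b"
  by (simp add: vec_eq_iff matrix_vector_mult_def hstack_def sum_UNIV_Plus)

lemma vstack_mult:
  fixes A :: "real^'n::finite^'p::finite"
  shows "vstack A B *v y = vstack (A *v y) (B *v y)"
  by (simp add: vec_eq_Plus_iff matrix_vector_mult_def)

lemma mult_hstack:
  fixes A :: "real^'n::finite^'m::finite"
  shows "A ** hstack B C = hstack (A ** B) (A ** C)"
  by (simp add: vec_eq_Plus_iff vec_eq_iff[where 'b='m] matrix_matrix_mult_def hstack_def)

lemma mult_vstack_0:
  fixes A :: "real^('p::finite + 'q::finite)^('p + 'q)"
  shows "A *v vstack 0 e = vstack (block12 A *v e) (block22 A *v e)"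
  by (simp add: vec_eq_Plus_iff matrix_vector_mult_def sum_UNIV_Plus block12_def block22_def)

lemma bounded_linear_vstack_0: "bounded_linear (vstack (0 :: real^'p::finite) :: real^'q::finite \<Rightarrow> _)"
  unfolding linear_conv_bounded_linear[symmetric]
  by (auto intro!: linearI simp: vec_eq_Plus_iff)

lemma bounded_linear_hstack_0:
  "bounded_linear (\<lambda>A :: real^'p::finite^'m::finite. hstack A (0 :: real^'q::finite^'m))"
  unfolding linear_conv_bounded_linear[symmetric]
  by (auto intro!: linearI simp: vec_eq_Plus_iff vec_eq_iff[where 'b='m] hstack_def)

lemma norm_vstack_0 [simp]: "norm (vstack (0 :: real^'p::finite) e) = norm (e :: real^'q::finite)"
  by (simp add: norm_vec_def L2_set_def sum_UNIV_Plus)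

section \<open>Quadratic forms and the Loewner order\<close>

lemma loewner_leD:
  assumes "A \<preceq>\<^sub>L B"
  shows "v \<bullet> (A *v v) \<le> v \<bullet> (B *v v)"
  using assms unfolding loewner_le_def pos_semidef_def
  by (auto simp: matrix_vector_mult_diff_rdistrib inner_diff_right)

lemma loewner_lessD:
  assumes "A \<prec>\<^sub>L B" "v \<noteq> 0"
  shows "v \<bullet> (A *v v) < v \<bullet> (B *v v)"
  using assms unfolding loewner_less_def pos_def_def
  by (auto simp: matrix_vector_mult_diff_rdistrib inner_diff_right)

lemma inner_matrix_transpose:
  fixes M :: "real^'n::finite^'n"
  shows "u \<bullet> (transpose M *v v) = v \<bullet> (M *v u)"
  by (metis dot_lmul_matrix inner_commute transpose_matrix_vector)

section \<open>Continuity and derivative of the matrix inverse\<close>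

lemma invertible_matrix_inv:
  fixes A :: "real^'n::finite^'n"
  assumes "invertible A"
  shows "A ** matrix_inv A = mat 1" "matrix_inv A ** A = mat 1"
  using assms someI_ex[of "\<lambda>B. A ** B = mat 1 \<and> B ** A = mat 1"]
  unfolding invertible_def matrix_inv_def by auto

text \<open>Difference quotients let the derivative of an inverse be found by passing to the limit
  in an exact algebraic identity.\<close>

lemma has_vector_derivative_iff_slope:
  fixes g :: "real \<Rightarrow> 'a::real_normed_vector"
  shows "(g has_vector_derivative g') (at t within S) \<longleftrightarrow>
    ((\<lambda>s. (1 / (s - t)) *\<^sub>R (g s - g t)) \<longlongrightarrow> g') (at t within S)"
proof -
  have *: "norm (g s - g t - (s - t) *\<^sub>R g') / norm (s - t) =
      norm ((1 / (s - t)) *\<^sub>R (g s - g t) - g')" if "s \<noteq> t" for s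
  proof -
    have "(1 / (s - t)) *\<^sub>R (g s - g t) - g' = (1 / (s - t)) *\<^sub>R (g s - g t - (s - t) *\<^sub>R g')"
      using that by (simp add: scaleR_diff_right)
    then show ?thesis by simp
  qed
  have "(g has_vector_derivative g') (at t within S) \<longleftrightarrow>
      ((\<lambda>s. norm (g s - g t - (s - t) *\<^sub>R g') / norm (s - t)) \<longlongrightarrow> 0) (at t within S)"
    unfolding has_vector_derivative_def has_derivative_iff_norm
    by (simp add: bounded_linear_scaleR_left)
  also have "\<dots> \<longleftrightarrow> ((\<lambda>s. norm ((1 / (s - t)) *\<^sub>R (g s - g t) - g')) \<longlongrightarrow> 0) (at t within S)"
    by (rule Lim_cong_within) (auto simp: * simp del: real_norm_def)
  also have "\<dots> \<longleftrightarrow> ((\<lambda>s. (1 / (s - t)) *\<^sub>R (g s - g t)) \<longlongrightarrow> g') (at t within S)"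
    by (simp only: tendsto_norm_zero_iff LIM_zero_iff)
  finally show ?thesis .
qed

text \<open>Expand the product on the right and cancel each matrix against its inverse. This
  resolvent identity drives both the continuity and the derivative of inversion.\<close>

lemma matrix_inv_diff:
  fixes A B :: "real^'n::finite^'n"
  assumes "invertible A" "invertible B"
  shows "matrix_inv B - matrix_inv A = - (matrix_inv B ** (B - A) ** matrix_inv A)"
proof -
  note bb = bounded_bilinear_matrix_matrix_mult
  have "matrix_inv B ** (B - A) ** matrix_inv A =
      matrix_inv B ** B ** matrix_inv A - matrix_inv B ** (A ** matrix_inv A)"
    by (simp only: bounded_bilinear.diff_left[OF bb] bounded_bilinear.diff_right[OF bb]
        matrix_mul_assoc)
  then show ?thesis
    by (simp add: invertible_matrix_inv assms)
qed

text \<open>The resolvent identity bounds the difference of the inverses by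
  \<open>norm (matrix_inv (M s)) * \<delta> s\<close> with \<open>\<delta>\<close> tending to 0. The
  first factor has no bound in advance; it gets one by absorption once
  \<open>\<delta> s < 1 / 2\<close>.\<close>

lemma tendsto_matrix_inv:
  fixes M :: "'a \<Rightarrow> real^'n::finite^'n"
  assumes M: "(M \<longlongrightarrow> A) F" and A: "invertible A" and inv: "\<forall>\<^sub>F s in F. invertible (M s)"
  shows "((\<lambda>s. matrix_inv (M s)) \<longlongrightarrow> matrix_inv A) F"
proof -
  let ?N = "\<lambda>s. matrix_inv (M s)" and ?a = "norm (matrix_inv A)"
  obtain K where K: "K > 0" "\<And>(a :: real^'n^'n) (b :: real^'n^'n). norm (a ** b) \<le> norm a * norm b * K"
    using bounded_bilinear.pos_bounded[OF bounded_bilinear_matrix_matrix_mult] by blast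
  define \<delta> where "\<delta> s = norm (M s - A) * ?a * K * K" for s
  have \<delta>: "(\<delta> \<longlongrightarrow> norm (A - A) * ?a * K * K) F"
    unfolding \<delta>_def by (intro tendsto_intros M)
  have diff: "norm (?N s - matrix_inv A) \<le> norm (?N s) * \<delta> s" if "invertible (M s)" for s
  proof -
    have "norm (?N s - matrix_inv A) = norm (?N s ** (M s - A) ** matrix_inv A)"
      by (simp add: matrix_inv_diff[OF A that])
    also have "\<dots> \<le> norm (?N s ** (M s - A)) * ?a * K" by (rule K(2))
    also have "\<dots> \<le> (norm (?N s) * norm (M s - A) * K) * ?a * K"
      using K(1) by (intro mult_right_mono K(2)) auto
    finally show ?thesis by (simp add: \<delta>_def ac_simps)
  qed
  have "\<forall>\<^sub>F s in F. \<delta> s < 1 / 2"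
    using order_tendstoD(2)[OF \<delta>, of "1/2"] by simp
  with inv have "\<forall>\<^sub>F s in F. norm (?N s - matrix_inv A) \<le> 2 * ?a * \<delta> s"
  proof eventually_elim
    case (elim s)
    have "\<delta> s \<ge> 0" using K(1) by (simp add: \<delta>_def)
    \<comment> \<open>Half of \<open>norm (?N s)\<close> is absorbed into the left-hand side, which
      leaves the factor 2.\<close>
    have "norm (?N s) \<le> ?a + norm (?N s - matrix_inv A)"
      by (rule norm_triangle_sub)
    also have "\<dots> \<le> ?a + norm (?N s) * (1 / 2)"
      using elim(2) by (intro add_left_mono order_trans[OF diff[OF elim(1)]] mult_left_mono) auto
    finally have "norm (?N s) \<le> 2 * ?a" by simp
    then show ?case
      using \<open>\<delta> s \<ge> 0\<close> by (intro order_trans[OF diff[OF elim(1)]] mult_right_mono)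
  qed
  moreover have "((\<lambda>s. 2 * ?a * \<delta> s) \<longlongrightarrow> 0) F"
    using tendsto_mult_left[OF \<delta>, of "2 * ?a"] by simp
  ultimately have "((\<lambda>s. ?N s - matrix_inv A) \<longlongrightarrow> 0) F"
    by (rule Lim_null_comparison)
  then show ?thesis by (simp add: LIM_zero_iff)
qed

text \<open>By the resolvent identity the difference quotient of the inverse is that of
  \<open>M\<close>, multiplied by \<open>matrix_inv (M s)\<close> on the left and
  \<open>matrix_inv (M t)\<close> on the right and negated; continuity of the inverse then gives the
  limit.\<close>

lemma has_vector_derivative_matrix_inv:
  fixes M :: "real \<Rightarrow> real^'n::finite^'n"
  assumes M: "(M has_vector_derivative M') (at t within S)"
    and t: "t \<in> S" and inv: "\<And>s. s \<in> S \<Longrightarrow> invertible (M s)"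
  shows "((\<lambda>s. matrix_inv (M s)) has_vector_derivative
    - (matrix_inv (M t) ** M' ** matrix_inv (M t))) (at t within S)"
proof -
  note [tendsto_intros] = bounded_bilinear.tendsto[OF bounded_bilinear_matrix_matrix_mult]
  have "(M \<longlongrightarrow> M t) (at t within S)"
    using has_vector_derivative_continuous[OF M] by (simp add: continuous_within)
  then have "((\<lambda>s. matrix_inv (M s)) \<longlongrightarrow> matrix_inv (M t)) (at t within S)"
    by (rule tendsto_matrix_inv) (auto simp: inv t eventually_at_filter)
  then have "((\<lambda>s. - (matrix_inv (M s) ** ((1 / (s - t)) *\<^sub>R (M s - M t)) ** matrix_inv (M t)))
      \<longlongrightarrow> - (matrix_inv (M t) ** M' ** matrix_inv (M t))) (at t within S)"
    using M unfolding has_vector_derivative_iff_slope by (intro tendsto_intros)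
  then show ?thesis
    unfolding has_vector_derivative_iff_slope
  proof (rule Lim_transform_within[where d=1])
    fix s assume "s \<in> S"
    then show "- (matrix_inv (M s) ** ((1 / (s - t)) *\<^sub>R (M s - M t)) ** matrix_inv (M t)) =
        (1 / (s - t)) *\<^sub>R (matrix_inv (M s) - matrix_inv (M t))"
      by (simp add: matrix_inv_diff inv t bounded_bilinear.scaleR_left[OF bounded_bilinear_matrix_matrix_mult]
          bounded_bilinear.scaleR_right[OF bounded_bilinear_matrix_matrix_mult])
  qed simp
qed

lemma pos_def_invertible:
  fixes M :: "real^'n::finite^'n"
  assumes "\<And>v. v \<noteq> 0 \<Longrightarrow> 0 < v \<bullet> (M *v v)"
  shows "invertible M"
  unfolding invertible_left_inverse matrix_left_invertible_ker
  using assms by (metis inner_zero_right less_irrefl)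

subsection \<open>Smooth maps and Lyapunov estimates\<close>

lemma smooth_on_imp_differentiable_on: "smooth_on g S \<Longrightarrow> g differentiable_on S"
  unfolding smooth_on_def by (metis Ck_on.simps(2))

lemma smooth_on_imp_continuous_on: "smooth_on g S \<Longrightarrow> continuous_on S g"
  unfolding smooth_on_def by (metis Ck_on.simps(1))

lemma smooth_on_imp_continuous_on_frechet_derivative:
  assumes "smooth_on g S"
  shows "continuous_on S (\<lambda>z. frechet_derivative g (at z within S) v)"
  using assms unfolding smooth_on_def by (metis Ck_on.simps)

text \<open>The slice at fixed \<open>t\<close> lies inside the set and is a full copy of the
  \<open>x\<close>-space, so a derivative relative to the set yields an unrestricted one in
  \<open>x\<close>, even when \<open>t\<close> is a boundary point of \<open>S\<close>.\<close>

lemma has_derivative_fst_section: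
  assumes "((\<lambda>(x, t). f x t) has_derivative D) (at (x, t) within UNIV \<times> S)" "t \<in> S"
  shows "((\<lambda>z. f z t) has_derivative (\<lambda>h. D (h, 0))) (at x)"
proof -
  have "((\<lambda>z. (z, t)) has_derivative (\<lambda>h. (h, 0))) (at x)"
    by (auto intro!: derivative_eq_intros)
  moreover have "((\<lambda>(x, t). f x t) has_derivative D) (at (x, t) within range (\<lambda>z. (z, t)))"
    by (rule has_derivative_subset[OF assms(1)]) (use assms(2) in auto)
  ultimately show ?thesis
    using has_derivative_in_compose[of "\<lambda>z. (z, t)" "\<lambda>h. (h, 0)" x UNIV "\<lambda>(x, t). f x t" D]
    by simp
qed

text \<open>The derivative in \<open>x\<close> is bounded on the compact set
  \<open>cball 0 r \<times> {0..T}\<close>, and the ball is convex, so the mean value inequality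
  applies.\<close>

lemma smooth_on_lipschitz:
  fixes f :: "'a::euclidean_space \<Rightarrow> real \<Rightarrow> 'b::euclidean_space"
  assumes f: "smooth_on (\<lambda>(x, t). f x t) (UNIV \<times> {0..})"
  shows "\<exists>L\<ge>0. \<forall>t\<in>{0..T}. \<forall>u\<in>cball 0 r. \<forall>v\<in>cball 0 r. norm (f u t - f v t) \<le> L * norm (u - v)"
proof -
  let ?f = "\<lambda>(x, t). f x t" and ?S = "UNIV \<times> {0..} :: ('a \<times> real) set"
  define D where "D z = frechet_derivative ?f (at z within ?S)" for z
  \<comment> \<open>Smoothness provides continuity of the derivative in each fixed direction; the
    sum over the finite basis is a continuous upper bound for the operator norm of the derivative in
    \<open>x\<close>.\<close>
  define N where "N z = (\<Sum>b\<in>Basis. norm (D z (b, 0)))" for z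
  have D: "((\<lambda>z. f z t) has_derivative (\<lambda>h. D (x, t) (h, 0))) (at x)" if "t \<ge> 0" for x t
  proof (rule has_derivative_fst_section)
    show "(?f has_derivative D (x, t)) (at (x, t) within ?S)"
      using smooth_on_imp_differentiable_on[OF f] that
      unfolding D_def differentiable_on_def frechet_derivative_works by auto
  qed (use that in auto)
  have "continuous_on (cball 0 r \<times> {0..T}) N"
    unfolding N_def D_def
    by (intro continuous_intros
          continuous_on_subset[OF smooth_on_imp_continuous_on_frechet_derivative[OF f]]) auto
  then have "compact (N ` (cball 0 r \<times> {0..T}))"
    by (intro compact_continuous_image compact_Times) auto
  then obtain B where B: "\<And>z. z \<in> cball 0 r \<times> {0..T} \<Longrightarrow> norm (N z) \<le> B"
    by (fastforce dest!: compact_imp_bounded simp: bounded_iff)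
  have "norm (f u t - f v t) \<le> max B 0 * norm (u - v)"
    if t: "t \<in> {0..T}" and uv: "u \<in> cball 0 r" "v \<in> cball 0 r" for t u v
  proof (rule differentiable_bound[OF convex_cball _ _ uv])
    fix x :: 'a assume x: "x \<in> cball 0 r"
    have Dx: "((\<lambda>z. f z t) has_derivative (\<lambda>h. D (x, t) (h, 0))) (at x)"
      using D t by auto
    then show "((\<lambda>z. f z t) has_derivative (\<lambda>h. D (x, t) (h, 0))) (at x within cball 0 r)"
      by (rule has_derivative_at_withinI)
    have lin: "linear (\<lambda>h. D (x, t) (h, 0))"
      using Dx by (rule has_derivative_linear)
    show "onorm (\<lambda>h. D (x, t) (h, 0)) \<le> max B 0"
    proof (rule onorm_bound)
      fix h :: 'a
      have "D (x, t) (h, 0) = (\<Sum>b\<in>Basis. (h \<bullet> b) *\<^sub>R D (x, t) (b, 0))"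
        using linear_sum[OF lin, of "\<lambda>b. (h \<bullet> b) *\<^sub>R b" Basis]
        by (simp add: euclidean_representation linear_cmul[OF lin])
      also have "norm \<dots> \<le> (\<Sum>b\<in>Basis. norm (D (x, t) (b, 0)) * norm h)"
        by (intro sum_norm_le) (auto simp: mult.commute intro!: mult_right_mono Basis_le_norm)
      also have "\<dots> = N (x, t) * norm h" by (simp add: N_def sum_distrib_right)
      also have "\<dots> \<le> max B 0 * norm h"
        using B[of "(x, t)"] x t by (intro mult_right_mono) auto
      finally show "norm (D (x, t) (h, 0)) \<le> max B 0 * norm h" .
    qed simp
  qed
  then show ?thesis by (intro exI[of _ "max B 0"]) auto
qed

text \<open>The mean value theorem has no equality form for vector-valued maps, so the increment is
  first contracted with \<open>e\<close> and \<open>hstack N M\<close>. One intermediate point then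
  serves, and the matrix inequality there is tested on the same \<open>e\<close>.\<close>

lemma lmi_increment:
  fixes g :: "real^('p::finite + 'q::finite) \<Rightarrow> real^('p + 'q)" and M M' :: "real^'q^'q"
  assumes g: "\<And>z. g differentiable (at z)"
    and lmi: "\<And>z. M' + N ** block12 (jacobian g (at z)) + transpose (block12 (jacobian g (at z))) ** transpose N
        + M ** block22 (jacobian g (at z)) + transpose (block22 (jacobian g (at z))) ** M
      \<preceq>\<^sub>L - (2 * rate) *\<^sub>R M"
    and sym: "transpose M = M"
  shows "e \<bullet> (M' *v e) + 2 * (e \<bullet> (hstack N M *v (g (x + vstack 0 e) - g x)))
    \<le> - 2 * rate * (e \<bullet> (M *v e))"
proof -
  define h where "h = (vstack 0 e :: real^('p + 'q))"
  define \<phi> where "\<phi> s = e \<bullet> (hstack N M *v g (x + s *\<^sub>R h))" for s :: real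
  define \<phi>' where "\<phi>' s = e \<bullet> (hstack N M *v (jacobian g (at (x + s *\<^sub>R h)) *v h))" for s :: real
  have der: "(\<phi> has_real_derivative \<phi>' s) (at s)" for s
  proof -
    have "((\<lambda>s. x + s *\<^sub>R h) has_vector_derivative h) (at s)"
      by (auto intro!: derivative_eq_intros)
    moreover have "(g has_derivative (\<lambda>v. jacobian g (at (x + s *\<^sub>R h)) *v v)) (at (x + s *\<^sub>R h))"
      using g jacobian_works by blast
    ultimately have "((\<lambda>s. g (x + s *\<^sub>R h)) has_vector_derivative
        jacobian g (at (x + s *\<^sub>R h)) *v h) (at s)"
      using vector_derivative_diff_chain_within[of "\<lambda>s. x + s *\<^sub>R h" h s UNIV g]
      by (auto simp: o_def intro: has_derivative_at_withinI)
    from bounded_linear.has_vector_derivative[OF bounded_linear_inner_right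
        bounded_linear.has_vector_derivative[OF matrix_vector_mul_bounded_linear this]]
    show ?thesis
      unfolding \<phi>_def \<phi>'_def has_real_derivative_iff_has_vector_derivative .
  qed
  obtain \<xi> where "\<phi> 1 - \<phi> 0 = (1 - 0) * \<phi>' \<xi>"
    using MVT2[of 0 1 \<phi> \<phi>'] der by auto
  moreover have "\<phi> 1 - \<phi> 0 = e \<bullet> (hstack N M *v (g (x + vstack 0 e) - g x))"
    by (simp add: \<phi>_def h_def inner_diff_right matrix_vector_mult_diff_distrib)
  moreover have "e \<bullet> (M' *v e) + 2 * \<phi>' \<xi> \<le> - 2 * rate * (e \<bullet> (M *v e))"
  proof -
    let ?J = "jacobian g (at (x + \<xi> *\<^sub>R h))"
    have "\<phi>' \<xi> = e \<bullet> ((N ** block12 ?J) *v e) + e \<bullet> ((M ** block22 ?J) *v e)"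
      by (simp add: \<phi>'_def h_def mult_vstack_0 hstack_mult_vstack inner_add_right
          matrix_vector_mul_assoc)
    \<comment> \<open>A matrix and its transpose have the same quadratic form; this accounts for the
      factor 2 in front of the increment.\<close>
    moreover have "transpose (block12 ?J) ** transpose N = transpose (N ** block12 ?J)"
      "transpose (block22 ?J) ** M = transpose (M ** block22 ?J)"
      by (simp_all add: matrix_transpose_mul sym)
    ultimately show ?thesis
      using loewner_leD[OF lmi[of "x + \<xi> *\<^sub>R h"], of e]
      by (simp add: matrix_vector_mult_add_rdistrib inner_add_right inner_matrix_transpose
          bounded_bilinear.minus_left[OF bounded_bilinear_matrix_vector_mult]
          del: transpose_matrix_vector flip: scaleR_matrix_vector_assoc)
  qed
  ultimately show ?thesis by simp
qed

text \<open>Gronwall's argument with the integrating factor \<open>exp (2 * rate * t)\<close>.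
  Derivatives are taken within \<open>{0..T}\<close>, so it also applies to a curve that obeys the
  differential inequality only up to time \<open>T\<close>.\<close>

lemma quadratic_form_decay:
  fixes M :: "real \<Rightarrow> real^'n::finite^'n"
  assumes T: "T \<ge> 0"
    and e: "\<And>t. t \<in> {0..T} \<Longrightarrow> (e has_vector_derivative e' t) (at t within {0..T})"
    and M: "\<And>t. t \<in> {0..T} \<Longrightarrow> (M has_vector_derivative M' t) (at t within {0..T})"
    and sym: "\<And>t. t \<in> {0..T} \<Longrightarrow> transpose (M t) = M t"
    and diss: "\<And>t. t \<in> {0..T} \<Longrightarrow>
      e t \<bullet> (M' t *v e t) + 2 * (e t \<bullet> (M t *v e' t)) \<le> - 2 * rate * (e t \<bullet> (M t *v e t))"
  shows "e T \<bullet> (M T *v e T) \<le> exp (- 2 * rate * T) * (e 0 \<bullet> (M 0 *v e 0))"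
proof -
  define V where "V t = e t \<bullet> (M t *v e t)" for t
  define V' where "V' t = e t \<bullet> (M' t *v e t) + 2 * (e t \<bullet> (M t *v e' t))" for t
  have V: "(V has_real_derivative V' t) (at t within {0..T})" if t: "t \<in> {0..T}" for t
  proof -
    \<comment> \<open>Symmetry of \<open>M t\<close> makes the two terms containing
      \<open>e'\<close> equal.\<close>
    have "e' t \<bullet> (M t *v e t) = e t \<bullet> (M t *v e' t)"
      using inner_matrix_transpose[of "e' t" "M t" "e t"] sym[OF t] by simp
    then have "V' t = e t \<bullet> (M t *v e' t + M' t *v e t) + e' t \<bullet> (M t *v e t)"
      by (simp add: V'_def inner_add_right)
    with bounded_bilinear.has_vector_derivative[OF bounded_bilinear_inner e[OF t]
        bounded_bilinear.has_vector_derivative[OF bounded_bilinear_matrix_vector_mult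
          M[OF t] e[OF t]]]
    show ?thesis
      unfolding V_def has_real_derivative_iff_has_vector_derivative by simp
  qed
  define W where "W t = exp (2 * rate * t) * V t" for t
  have W: "(W has_real_derivative exp (2 * rate * t) * (2 * rate * V t + V' t)) (at t within {0..T})"
    if "t \<in> {0..T}" for t
    unfolding W_def using V[OF that] by (auto intro!: derivative_eq_intros simp: algebra_simps)
  have "W T \<le> W 0"
  proof (rule DERIV_nonpos_imp_decreasing_open[OF T])
    show "continuous_on {0..T} W"
      using W by (rule DERIV_continuous_on)
    fix t assume t: "0 < t" "t < T"
    then have "(W has_real_derivative exp (2 * rate * t) * (2 * rate * V t + V' t)) (at t)"
      using W[of t] at_within_interior[of t "{0..T}"] by simp
    moreover have "2 * rate * V t + V' t \<le> 0"
      using diss[of t] t by (simp add: V_def V'_def)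
    then have "exp (2 * rate * t) * (2 * rate * V t + V' t) \<le> 0"
      by (simp add: mult_nonneg_nonpos)
    ultimately show "\<exists>y. DERIV W t :> y \<and> y \<le> 0" by blast
  qed
  then have "exp (- 2 * rate * T) * (exp (2 * rate * T) * V T) \<le> exp (- 2 * rate * T) * V 0"
    by (intro mult_left_mono) (auto simp: W_def)
  then show ?thesis by (simp add: V_def exp_minus field_simps)
qed

subsection \<open>The reduced-order observer\<close>

text \<open>The first block of the estimate is the output itself, so it carries no error. The second
  is \<open>w\<close> minus the \<open>M21\<close> part of \<open>P x\<close>; subtracting the
  second block of \<open>x\<close> leaves \<open>w - P x\<close>.\<close>

lemma observer_estimate_error:
  "observer_estimate M21 M22 w (output_matrix *v x) t =
    x + vstack 0 (w - P_mat M21 M22 t *v x)"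
proof -
  define a b where "a = (\<chi> i. x $ Inl i)" and "b = (\<chi> j. x $ Inr j)"
  have x: "x = vstack a b" by (simp add: a_def b_def vstack_split)
  show ?thesis
    by (simp add: x observer_estimate_def output_matrix_def C_plus_def P_mat_def hstack_mult_vstack
        vstack_mult vec_eq_Plus_iff
        bounded_bilinear.minus_left[OF bounded_bilinear_matrix_vector_mult])
qed

lemma P_mat_mult_vstack_0: "P_mat M21 M22 t *v vstack 0 e = e"
  by (simp add: P_mat_def hstack_mult_vstack)

text \<open>Multiplication by \<open>M22\<close> cancels the inverse inside \<open>P\<close> and
  recovers the pair \<open>M21\<close>, \<open>M22\<close> that the matrix inequality
  controls.\<close>

lemma mult_P_mat:
  assumes "invertible (M22 t)"
  shows "M22 t *v (P_mat M21 M22 t *v d) = hstack (M21 t) (M22 t) *v d"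
  by (simp add: P_mat_def matrix_vector_mul_assoc mult_hstack matrix_mul_assoc
      invertible_matrix_inv assms)

text \<open>With the constant block split off, \<open>P\<close> is a constant plus a bounded linear
  image of its time-varying block, which reduces its differentiability to that block.\<close>

lemma P_mat_eq: "P_mat M21 M22 t = hstack (matrix_inv (M22 t) ** M21 t) 0 + hstack 0 (mat 1)"
  by (simp add: P_mat_def vec_eq_iff split_sum_all hstack_def)

lemma P_mat_differentiable:
  assumes M21: "M21 differentiable (at t within {0..})" and M22: "M22 differentiable (at t within {0..})"
    and t: "t \<ge> 0" and inv: "\<And>s. s \<ge> 0 \<Longrightarrow> invertible (M22 s)"
  shows "P_mat M21 M22 differentiable (at t within {0..})"
proof -
  obtain D21 D22 where "(M21 has_vector_derivative D21) (at t within {0..})"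
    and D22: "(M22 has_vector_derivative D22) (at t within {0..})"
    using M21 M22 unfolding vector_derivative_works by blast
  moreover have "((\<lambda>s. matrix_inv (M22 s)) has_vector_derivative
      - (matrix_inv (M22 t) ** D22 ** matrix_inv (M22 t))) (at t within {0..})"
    by (rule has_vector_derivative_matrix_inv[OF D22]) (use t inv in auto)
  ultimately have "((\<lambda>s. hstack (matrix_inv (M22 s) ** M21 s) 0 + hstack 0 (mat 1)) has_vector_derivative
      hstack (matrix_inv (M22 t) ** D21 + - (matrix_inv (M22 t) ** D22 ** matrix_inv (M22 t)) ** M21 t) 0 + 0)
      (at t within {0..})"
    by (intro has_vector_derivative_add has_vector_derivative_const
        bounded_linear.has_vector_derivative[OF bounded_linear_hstack_0]
        bounded_bilinear.has_vector_derivative[OF bounded_bilinear_matrix_matrix_mult])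
  then show ?thesis
    unfolding P_mat_eq[abs_def] by (rule differentiableI_vector)
qed

lemma has_time_deriv:
  assumes "g differentiable (at t within {0..})"
  shows "(g has_vector_derivative time_deriv g t) (at t within {0..})"
  using assms unfolding time_deriv_def vector_derivative_works .

lemma time_deriv_P_mat_mult_vstack_0:
  fixes M21 :: "real \<Rightarrow> real^'p::finite^'q::finite"
  assumes P: "P_mat M21 M22 differentiable (at t within {0..})" and t: "t \<ge> 0"
  shows "time_deriv (P_mat M21 M22) t *v vstack 0 e = 0"
proof -
  have "((\<lambda>s. P_mat M21 M22 s *v vstack 0 e) has_vector_derivative
      P_mat M21 M22 t *v 0 + time_deriv (P_mat M21 M22) t *v vstack 0 e) (at t within {0..})"
    by (intro bounded_bilinear.has_vector_derivative[OF bounded_bilinear_matrix_vector_mult]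
        has_vector_derivative_const has_time_deriv P)
  moreover have "((\<lambda>s. P_mat M21 M22 s *v vstack 0 e) has_vector_derivative 0) (at t within {0..})"
    by (simp add: P_mat_mult_vstack_0)
  \<comment> \<open>Uniqueness of the derivative relative to the half-line requires \<open>t\<close>
    to be a limit point of it; the points to the right of \<open>t\<close> show this, also for
    \<open>t = 0\<close>.\<close>
  moreover have "{t<..} \<subseteq> {0..}" using t by auto
  then have "at t within {0..} \<noteq> bot"
    using at_le[of "{t<..}" "{0..}" t] trivial_limit_at_right_real[of t] by (auto simp: bot_unique)
  ultimately show ?thesis
    by (auto dest: vector_derivative_unique_within)
qed

text \<open>The level set of \<open>R\<close> is compact and nonempty, so it has a least element. A
  value above \<open>R\<close> before that time would, by the intermediate value theorem, force an
  even earlier crossing.\<close>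

lemma first_exit_time:
  fixes g :: "real \<Rightarrow> real"
  assumes "continuous_on {0..b} g" "g 0 < R" "R < g b" "0 \<le> b"
  obtains \<tau> where "0 \<le> \<tau>" "\<tau> \<le> b" "g \<tau> = R" "\<And>s. s \<in> {0..\<tau>} \<Longrightarrow> g s \<le> R"
proof -
  define S where "S = {0..b} \<inter> g -` {R}"
  have S: "compact S"
    unfolding S_def using continuous_closed_preimage[OF assms(1)]
    by (metis closed_atLeastAtMost closed_singleton compact_Icc compact_Int_closed inf.idem inf_assoc)
  obtain s0 where "s0 \<in> S"
    using IVT'[of g 0 R b] assms by (auto simp: S_def)
  then obtain \<tau> where \<tau>: "\<tau> \<in> S" and min: "\<And>s. s \<in> S \<Longrightarrow> \<tau> \<le> s"
    using compact_attains_inf[OF S] by blast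
  have "g s \<le> R" if s: "s \<in> {0..\<tau>}" for s
  proof (rule ccontr)
    assume "\<not> g s \<le> R"
    then have "\<exists>u\<ge>0. u \<le> s \<and> g u = R"
      using s \<tau> assms(2) by (intro IVT' continuous_on_subset[OF assms(1)]) (auto simp: S_def)
    then obtain u where "0 \<le> u" "u \<le> s" "g u = R" by blast
    moreover from this have "\<tau> \<le> u" using min[of u] s \<tau> by (auto simp: S_def)
    ultimately have "u = s" using s by simp
    then show False using \<open>g u = R\<close> \<open>\<not> g s \<le> R\<close> by simp
  qed
  then show ?thesis using that[of \<tau>] \<tau> by (auto simp: S_def)
qed

theorem theorem5:
  fixes f :: "real^('p::finite + 'q::finite) \<Rightarrow> real \<Rightarrow> real^('p + 'q)"
    and M21 :: "real \<Rightarrow> real^'p^'q"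
    and M22 :: "real \<Rightarrow> real^'q^'q"
    and A :: "real^('p + 'q) \<Rightarrow> real \<Rightarrow> real^('p + 'q)^('p + 'q)"
    and rate \<alpha> :: real
  assumes f_smooth: "smooth_on (\<lambda>(x, t). f x t) (UNIV \<times> {0..})"
    and M21_smooth: "smooth_on M21 {0..}"
    and M22_smooth: "smooth_on M22 {0..}"
    and A_def: "\<And>x t. A x t = jacobian (\<lambda>z. f z t) (at x)"
    and rate_pos: "rate > 0"
    and alpha_pos: "\<alpha> > 0"
    and M22_sym: "\<And>t. t \<ge> 0 \<Longrightarrow> transpose (M22 t) = M22 t"
    and M22_lower: "\<And>t. t \<ge> 0 \<Longrightarrow> \<alpha> *\<^sub>R mat 1 \<prec>\<^sub>L M22 t"
    and lmi: "\<And>x t. t \<ge> 0 \<Longrightarrow>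
      time_deriv M22 t
        + M21 t ** block12 (A x t) + transpose (block12 (A x t)) ** transpose (M21 t)
        + M22 t ** block22 (A x t) + transpose (block22 (A x t)) ** M22 t
      \<preceq>\<^sub>L - (2 * rate) *\<^sub>R M22 t"
  shows "glob_exp_stable_observer f output_matrix
           (observer_field f M21 M22) (observer_estimate M21 M22) rate"
proof -
  define P where "P = P_mat M21 M22"
  \<comment> \<open>Compares the lower bound \<open>\<alpha>\<close> for the form at the final time
    with the operator norm at time 0. Neither the trajectory nor the initial observer state enters,
    as the uniformity of \<open>K\<close> demands.\<close>
  define K where "K = sqrt (onorm ((*v) (M22 0)) / \<alpha>)"
  \<comment> \<open>The right-hand side of the error equation, with the state \<open>x\<close> as an
    external signal.\<close>
  define \<Delta> where "\<Delta> x t e = P t *v (f (x + vstack 0 e) t - f x t)" for x t e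
  have K0: "K \<ge> 0"
    using alpha_pos by (simp add: K_def onorm_pos_le matrix_vector_mul_bounded_linear)

  \<comment> \<open>Positivity of \<open>M22\<close> and regularity of \<open>P\<close> and
    \<open>f\<close>\<close>
  have M22_ge: "\<alpha> * (norm v)\<^sup>2 \<le> v \<bullet> (M22 t *v v)" if "t \<ge> 0" for t v
    using loewner_lessD[OF M22_lower[OF that], of v]
    by (cases "v = 0")
       (auto simp: power2_norm_eq_inner less_imp_le simp flip: scaleR_matrix_vector_assoc)
  have inv: "invertible (M22 t)" if t: "t \<ge> 0" for t
  proof (rule pos_def_invertible)
    fix v :: "real^'q" assume "v \<noteq> 0"
    then have "0 < \<alpha> * (norm v)\<^sup>2" using alpha_pos by simp
    then show "0 < v \<bullet> (M22 t *v v)" using M22_ge[OF t, of v] by linarith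
  qed
  have M22_diff: "M22 differentiable (at t within {0..})"
    and M21_diff: "M21 differentiable (at t within {0..})" if "t \<ge> 0" for t
    using smooth_on_imp_differentiable_on M21_smooth M22_smooth that
    unfolding differentiable_on_def by auto
  have P_diff: "P differentiable (at t within {0..})" if "t \<ge> 0" for t
    unfolding P_def using that by (intro P_mat_differentiable M21_diff M22_diff inv)
  have P_cont: "continuous_on {0..} P"
    unfolding continuous_on_eq_continuous_within using P_diff
    by (auto intro: differentiable_imp_continuous_within)
  have f_diff: "(\<lambda>z. f z t) differentiable (at x)" if "t \<ge> 0" for x t
  proof -
    have "(\<lambda>(x, t). f x t) differentiable (at (x, t) within UNIV \<times> {0..})"
      using smooth_on_imp_differentiable_on[OF f_smooth] that
      unfolding differentiable_on_def by auto
    then show ?thesis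
      using has_derivative_fst_section[of f _ x t "{0..}"] that
      unfolding differentiable_def by (metis atLeast_iff)
  qed

  \<comment> \<open>Exponential decay of the error\<close>
  have decay: "norm (e T) \<le> K * exp (- rate * T) * norm (e 0)"
    if T: "T \<ge> 0" and e: "\<And>t. t \<in> {0..T} \<Longrightarrow>
      (e has_vector_derivative \<Delta> (x t) t (e t)) (at t within {0..T})" for x e T
  proof -
    \<comment> \<open>The signal \<open>x\<close> is arbitrary here, since the increment estimate
      holds at every base point.\<close>
    have "e T \<bullet> (M22 T *v e T) \<le> exp (- 2 * rate * T) * (e 0 \<bullet> (M22 0 *v e 0))"
    proof (rule quadratic_form_decay[OF T e])
      fix t assume "t \<in> {0..T}"
      then have t: "t \<ge> 0" by simp
      show "(M22 has_vector_derivative time_deriv M22 t) (at t within {0..T})"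
        by (rule has_vector_derivative_within_subset[OF has_time_deriv[OF M22_diff[OF t]]]) auto
      show "transpose (M22 t) = M22 t" by (rule M22_sym[OF t])
      show "e t \<bullet> (time_deriv M22 t *v e t) + 2 * (e t \<bullet> (M22 t *v \<Delta> (x t) t (e t)))
          \<le> - 2 * rate * (e t \<bullet> (M22 t *v e t))"
        unfolding \<Delta>_def P_def mult_P_mat[of M22 t, OF inv[OF t]]
        by (rule lmi_increment[OF f_diff[OF t] lmi[OF t, unfolded A_def] M22_sym[OF t]])
    qed
    also have "e 0 \<bullet> (M22 0 *v e 0) \<le> norm (e 0) * (onorm ((*v) (M22 0)) * norm (e 0))"
      by (intro order_trans[OF norm_cauchy_schwarz] mult_left_mono onorm
          matrix_vector_mul_bounded_linear) auto
    also have "\<dots> = \<alpha> * (K * norm (e 0))\<^sup>2"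
      using alpha_pos by (simp add: K_def power_mult_distrib onorm_pos_le power2_eq_square)
    finally have "\<alpha> * (norm (e T))\<^sup>2 \<le> exp (- 2 * rate * T) * (\<alpha> * (K * norm (e 0))\<^sup>2)"
      using M22_ge[OF T, of "e T"] by simp
    also have "\<dots> = \<alpha> * (K * exp (- rate * T) * norm (e 0))\<^sup>2"
      by (simp add: power_mult_distrib exp_double[symmetric] mult.assoc)
    finally have "(norm (e T))\<^sup>2 \<le> (K * exp (- rate * T) * norm (e 0))\<^sup>2"
      using alpha_pos by simp
    then show ?thesis by (rule power2_le_imp_le) (simp add: K0)
  qed

  \<comment> \<open>Global existence for the error equation\<close>
  have ex: "\<exists>e. e 0 = e0 \<and> (\<forall>t\<ge>0. (e has_vector_derivative \<Delta> (x t) t (e t)) (at t within {0..}))"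
    if x: "continuous_on {0..} x" for x :: "real \<Rightarrow> real^('p + 'q)" and e0 :: "real^'q"
  proof -
    \<comment> \<open>Strictly above \<open>norm e0\<close>, so that the error starts inside the
      ball, and strictly above \<open>K * norm e0\<close>, so that the decay estimate excludes the
      sphere.\<close>
    define R where "R = K * norm e0 + norm e0 + 1"
    have R: "K * norm e0 < R" "norm e0 < R" "R > 0"
      using K0 by (auto simp: R_def add_nonneg_pos add_pos_nonneg intro: le_less_trans)
    \<comment> \<open>The projection is nonexpansive and fixes the ball: it makes the field globally
      Lipschitz without changing it where the solution will stay.\<close>
    define \<pi> where "\<pi> = closest_point (cball (0 :: real^'q) R)"
    have \<pi>: "\<pi> v \<in> cball 0 R" "norm (\<pi> u - \<pi> v) \<le> norm (u - v)" for u v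
      using R(3) closest_point_in_set[of "cball 0 R" v]
        closest_point_lipschitz[of "cball 0 R" u v]
      by (auto simp: \<pi>_def dist_norm)
    have \<pi>_id: "\<pi> v = v" if "norm v \<le> R" for v
      unfolding \<pi>_def using that by (intro closest_point_self) auto
    have \<pi>_cont: "continuous_on UNIV \<pi>"
      unfolding \<pi>_def using R(3) by (intro continuous_on_closest_point) auto
    have "\<exists>e. e 0 = e0 \<and> ode_solution (\<lambda>v t. \<Delta> (x t) t (\<pi> v)) e"
    proof (rule ode_solution_exists)
      have f_cont: "continuous_on (UNIV \<times> {0..}) (\<lambda>(x, t). f x t)"
        by (rule smooth_on_imp_continuous_on[OF f_smooth])
      let ?S = "UNIV \<times> {0..} :: ((real^'q) \<times> real) set"
      have x': "continuous_on ?S (\<lambda>z. x (snd z))" and P': "continuous_on ?S (\<lambda>z. P (snd z))"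
        by (auto intro!: continuous_on_compose2[OF x] continuous_on_compose2[OF P_cont] continuous_intros)
      have \<pi>': "continuous_on ?S (\<lambda>z. vstack 0 (\<pi> (fst z)))"
        by (intro bounded_linear.continuous_on[OF bounded_linear_vstack_0]
            continuous_on_compose2[OF \<pi>_cont] continuous_intros) auto
      have f': "continuous_on ?S (\<lambda>z. f (g z) (snd z))" if "continuous_on ?S g" for g
        using continuous_on_compose2[OF f_cont continuous_on_Pair[OF that continuous_on_snd[OF continuous_on_id]]]
        by (simp add: image_subset_iff mem_Times_iff)
      show "continuous_on ?S (\<lambda>(v, t). \<Delta> (x t) t (\<pi> v))"
        unfolding \<Delta>_def case_prod_unfold
        by (intro bounded_bilinear.continuous_on[OF bounded_bilinear_matrix_vector_mult]
            continuous_intros f' x' P' \<pi>')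
    next
      fix T :: real
      have bounded: "\<exists>B. \<forall>t\<in>{0..T}. norm (g t) \<le> B" if "continuous_on {0..} g"
        for g :: "real \<Rightarrow> 'z::real_normed_vector"
      proof -
        have "bounded (g ` {0..T})"
          by (intro compact_imp_bounded compact_continuous_image continuous_on_subset[OF that]) auto
        then show ?thesis by (simp add: bounded_iff)
      qed
      obtain X B where X: "\<And>t. t \<in> {0..T} \<Longrightarrow> norm (x t) \<le> X"
        and B: "\<And>t. t \<in> {0..T} \<Longrightarrow> norm (P t) \<le> B"
        using bounded[OF x] bounded[OF P_cont] by blast
      obtain L where L0: "L \<ge> 0" and L: "\<And>t u v. \<lbrakk>t \<in> {0..T}; u \<in> cball 0 (X + R); v \<in> cball 0 (X + R)\<rbrakk>
          \<Longrightarrow> norm (f u t - f v t) \<le> L * norm (u - v)"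
        using smooth_on_lipschitz[OF f_smooth, of T "X + R"] by blast
      obtain c where c: "c > 0" "\<And>(Q :: real^('p + 'q)^'q) d. norm (Q *v d) \<le> norm Q * norm d * c"
        using bounded_bilinear.pos_bounded[OF bounded_bilinear_matrix_vector_mult] by blast
      have "norm (\<Delta> (x t) t (\<pi> u) - \<Delta> (x t) t (\<pi> v)) \<le> (B * L * c) * norm (u - v)"
        if t: "t \<in> {0..T}" for t u v
      proof -
        \<comment> \<open>All arguments of \<open>f\<close> in the truncated field lie in one ball,
          whatever \<open>v\<close> is, so the Lipschitz constant of \<open>f\<close> on that ball
          suffices.\<close>
        have mem: "x t + vstack 0 (\<pi> v) \<in> cball 0 (X + R)" for v
          using norm_triangle_ineq[of "x t" "vstack 0 (\<pi> v)"] X[OF t] \<pi>(1)[of v] by simp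
        have "norm (f (x t + vstack 0 (\<pi> u)) t - f (x t + vstack 0 (\<pi> v)) t)
            \<le> L * norm (vstack 0 (\<pi> u) - vstack 0 (\<pi> v) :: real^('p + 'q))"
          using L[OF t mem mem, of u v] by simp
        also have "\<dots> = L * norm (\<pi> u - \<pi> v)"
          by (simp add: linear_diff[OF bounded_linear.linear[OF bounded_linear_vstack_0], symmetric])
        also have "\<dots> \<le> L * norm (u - v)"
          by (intro mult_left_mono \<pi> L0)
        finally have *: "norm (f (x t + vstack 0 (\<pi> u)) t - f (x t + vstack 0 (\<pi> v)) t)
            \<le> L * norm (u - v)" .
        have "norm (\<Delta> (x t) t (\<pi> u) - \<Delta> (x t) t (\<pi> v)) =
            norm (P t *v (f (x t + vstack 0 (\<pi> u)) t - f (x t + vstack 0 (\<pi> v)) t))"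
          by (simp add: \<Delta>_def flip: matrix_vector_mult_diff_distrib)
        also have "\<dots> \<le> norm (P t) * norm (f (x t + vstack 0 (\<pi> u)) t - f (x t + vstack 0 (\<pi> v)) t) * c"
          by (rule c(2))
        also have "\<dots> \<le> B * (L * norm (u - v)) * c"
          using c(1) * B[OF t] order_trans[OF norm_ge_zero B[OF t]]
          by (intro mult_right_mono mult_mono) auto
        finally show ?thesis by (simp add: ac_simps)
      qed
      then show "\<exists>L. \<forall>t\<in>{0..T}. \<forall>u v. norm (\<Delta> (x t) t (\<pi> u) - \<Delta> (x t) t (\<pi> v)) \<le> L * norm (u - v)"
        by blast
    qed
    then obtain e where e0: "e 0 = e0" and e: "\<And>t. t \<ge> 0 \<Longrightarrow>
        (e has_vector_derivative \<Delta> (x t) t (\<pi> (e t))) (at t within {0..})"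
      unfolding ode_solution_def by blast
    have e_cont: "continuous_on {0..} e"
      unfolding continuous_on_eq_continuous_within
      using e by (auto intro: has_vector_derivative_continuous)
    have bound: "norm (e t) \<le> R" if t: "t \<ge> 0" for t
    proof (rule ccontr)
      assume "\<not> norm (e t) \<le> R"
      then obtain \<tau> where \<tau>: "0 \<le> \<tau>" "norm (e \<tau>) = R"
        and le: "\<And>s. s \<in> {0..\<tau>} \<Longrightarrow> norm (e s) \<le> R"
        using first_exit_time[of t "\<lambda>s. norm (e s)" R] t R(2) e0
          continuous_on_norm[OF continuous_on_subset[OF e_cont, of "{0..t}"]] by auto
      \<comment> \<open>Up to \<open>\<tau>\<close> the projection acts as the identity, so the
        decay estimate applies on \<open>{0..\<tau>}\<close> and keeps the norm below
        \<open>R\<close>, contrary to the choice of \<open>\<tau>\<close>.\<close>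
      have "norm (e \<tau>) \<le> K * exp (- rate * \<tau>) * norm (e 0)"
      proof (rule decay[OF \<tau>(1)])
        fix s assume s: "s \<in> {0..\<tau>}"
        have "(e has_vector_derivative \<Delta> (x s) s (\<pi> (e s))) (at s within {0..\<tau>})"
          by (rule has_vector_derivative_within_subset[OF e]) (use s in auto)
        then show "(e has_vector_derivative \<Delta> (x s) s (e s)) (at s within {0..\<tau>})"
          using \<pi>_id[OF le[OF s]] by simp
      qed
      also have "\<dots> \<le> K * 1 * norm (e 0)"
        using K0 rate_pos \<tau>(1) by (intro mult_right_mono mult_left_mono) auto
      finally show False using \<tau>(2) R(1) e0 by simp
    qed
    have "(e has_vector_derivative \<Delta> (x t) t (e t)) (at t within {0..})" if "t \<ge> 0" for t
      using e[OF that] \<pi>_id[OF bound[OF that]] by simp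
    with e0 show ?thesis by blast
  qed

  \<comment> \<open>Passage between the observer state and the error\<close>
  show ?thesis
    unfolding glob_exp_stable_observer_def
  proof (intro exI[of _ K] allI impI)
    fix x :: "real \<Rightarrow> real^('p + 'q)" and w0 :: "real^'q"
    assume "ode_solution f x"
    then have x: "(x has_vector_derivative f (x t) t) (at t within {0..})" if "t \<ge> 0" for t
      using that unfolding ode_solution_def by blast
    let ?ode = "ode_solution (\<lambda>v t. observer_field f M21 M22 v (output_matrix *v x t) t)"
    have Px: "((\<lambda>t. P t *v x t) has_vector_derivative
        P t *v f (x t) t + time_deriv P t *v x t) (at t within {0..})" if "t \<ge> 0" for t
      using that by (intro bounded_bilinear.has_vector_derivative[OF bounded_bilinear_matrix_vector_mult]
        x has_time_deriv P_diff)
    \<comment> \<open>The first two terms are the derivative of \<open>P x\<close>, so subtracting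
      them from the observer equation leaves exactly the error equation for
      \<open>w - P x\<close>.\<close>
    have field: "observer_field f M21 M22 w (output_matrix *v x t) t =
        P t *v f (x t) t + time_deriv P t *v x t + \<Delta> (x t) t (w - P t *v x t)" if "t \<ge> 0" for t w
      using time_deriv_P_mat_mult_vstack_0[OF P_diff[OF that, unfolded P_def] that]
      by (simp add: observer_field_def Let_def observer_estimate_error \<Delta>_def P_def
          matrix_vector_right_distrib matrix_vector_mult_diff_distrib)
    have "\<exists>w. w 0 = w0 \<and> ?ode w"
    proof -
      have "continuous_on {0..} x"
        unfolding continuous_on_eq_continuous_within
        using x by (auto intro: has_vector_derivative_continuous)
      from ex[OF this, of "w0 - P 0 *v x 0"] obtain e where
        e0: "e 0 = w0 - P 0 *v x 0" and
        e: "\<And>t. t \<ge> 0 \<Longrightarrow> (e has_vector_derivative \<Delta> (x t) t (e t)) (at t within {0..})"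
        by blast
      \<comment> \<open>Undoing the change of variable turns the global error solution into an
        observer solution starting at \<open>w0\<close>.\<close>
      have "?ode (\<lambda>t. P t *v x t + e t)"
        unfolding ode_solution_def
      proof (intro allI impI)
        fix t :: real assume t: "t \<ge> 0"
        show "((\<lambda>t. P t *v x t + e t) has_vector_derivative
            observer_field f M21 M22 (P t *v x t + e t) (output_matrix *v x t) t) (at t within {0..})"
          unfolding field[OF t] using has_vector_derivative_add[OF Px[OF t] e[OF t]] by simp
      qed
      then show ?thesis using e0 by (intro exI[of _ "\<lambda>t. P t *v x t + e t"]) simp
    qed
    moreover have "norm (observer_estimate M21 M22 (w t) (output_matrix *v x t) t - x t) \<le>
        K * exp (- rate * t) * norm (observer_estimate M21 M22 (w 0) (output_matrix *v x 0) 0 - x 0)"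
      if w: "?ode w" and t: "t \<ge> 0" for w t
    proof -
      \<comment> \<open>Here \<open>w\<close> is any observer solution, so the bound covers all of
        them and not only the one constructed above.\<close>
      define e where "e s = w s - P s *v x s" for s
      have "norm (e t) \<le> K * exp (- rate * t) * norm (e 0)"
      proof (rule decay[OF t])
        fix s assume "s \<in> {0..t}"
        then have s: "s \<ge> 0" by simp
        have "(w has_vector_derivative observer_field f M21 M22 (w s) (output_matrix *v x s) s)
            (at s within {0..})"
          using w s unfolding ode_solution_def by blast
        from has_vector_derivative_diff[OF this Px[OF s]]
        have "(e has_vector_derivative \<Delta> (x s) s (e s)) (at s within {0..})"
          unfolding field[OF s] e_def[abs_def] by simp
        then show "(e has_vector_derivative \<Delta> (x s) s (e s)) (at s within {0..t})"
          by (rule has_vector_derivative_within_subset) auto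
      qed
      then show ?thesis
        by (simp add: observer_estimate_error e_def P_def)
    qed
    ultimately show "(\<exists>w. w 0 = w0 \<and> ?ode w) \<and>
        (\<forall>w. w 0 = w0 \<and> ?ode w \<longrightarrow> (\<forall>t\<ge>0.
          norm (observer_estimate M21 M22 (w t) (output_matrix *v x t) t - x t) \<le>
          K * exp (- rate * t) * norm (observer_estimate M21 M22 (w 0) (output_matrix *v x 0) 0 - x 0)))"
      by blast
  qed
qed

end
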